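(* Let $T$ be a translatable semigroup and let $h\ge 2$ be an integer. Then $S_T(h)\le 2h$. In fact, if $A$ is an additive basis of $T$ of order at most $h$, then there are at most $h(h-1)$ elements $a$ of $A$ such that $\mathrm{ord}_T^*(A\setminus\{a\})>2h$. If $T$ is a group, then the number of such elements is at most $2(h-1)$.
   Context: For subsets $A,B$ of an abelian semigroup, $A\sim B$ means that the symmetric difference of $A$ and $B$ is finite. A translatable semigroup is an infinite cancellative abelian semigroup $(T,+)$ such that for every $x\in T$ the set $T\setminus(x+T)$ is finite. $hA$ denotes the $h$-fold Minkowski sum $A+\cdots+A$ ($h\ge 1$ copies). A subset $A\subset T$ is an additive basis of $T$ if $hA\sim T$ for some integer $h\ge 1$; the smallest such $h$ is its order $\mathrm{ord}^*_T(A)$, and $\mathrm{ord}_T^*(A)=\infty$ if $A$ is not an additive basis of $T$. $S_T(h)$ is the minimum $s$ such that for any additive basis $A$ of $T$ with $\mathrm{ord}_T^*(A)\le h$, there are only finitely many elements $a\in A$ with $\mathrm{ord}_T^*(A\setminus\{a\})>s$. *)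

theory Defs
  imports Main "HOL-Library.Set_Algebras" "HOL-Library.Extended_Nat"
begin

(* The class cancel_ab_semigroup_add is avoided on purpose: it carries a subtraction
   operation with axioms that are not part of the notion of a cancellative abelian semigroup. *)
class translatable_semigroup = ab_semigroup_add + cancel_semigroup_add +
  assumes infinite_carrier: "infinite (UNIV :: 'a set)"
    and finite_compl_translate: "finite (UNIV - range ((+) x))"

definition is_group :: "'a::semigroup_add itself \<Rightarrow> bool" where
  "is_group _ \<longleftrightarrow> (\<exists>z inv. group ((+) :: 'a \<Rightarrow> 'a \<Rightarrow> 'a) z inv)"

definition almost_eq :: "'a set \<Rightarrow> 'a set \<Rightarrow> bool" where
  "almost_eq A B \<longleftrightarrow> finite (sym_diff A B)"

(* The sum of h copies of A, meaningful for h \<ge> 1 only, since there need not be a neutral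
   element; sumset 0 A = A is a junk value, and all uses below require h \<ge> 1. *)
definition sumset :: "nat \<Rightarrow> 'a::plus set \<Rightarrow> 'a set" where
  "sumset h A = (((+) A) ^^ (h - 1)) A"

definition additive_basis :: "'a::plus set \<Rightarrow> bool" where
  "additive_basis A \<longleftrightarrow> (\<exists>h\<ge>1. almost_eq (sumset h A) UNIV)"

(* The infimum of the empty set in enat is \<infinity>. *)
definition basis_ord :: "'a::plus set \<Rightarrow> enat" where
  "basis_ord A = (INF h \<in> {h. h \<ge> 1 \<and> almost_eq (sumset h A) UNIV}. enat h)"

definition S_fun :: "'a::plus itself \<Rightarrow> nat \<Rightarrow> enat" where
  "S_fun _ h = (INF s \<in> {s :: nat. \<forall>A :: 'a set. additive_basis A \<and> basis_ord A \<le> enat h \<longrightarrow>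
      finite {a \<in> A. basis_ord (A - {a}) > enat s}}. enat s)"

lemma sumset_1: "sumset 1 A = A"
  by (simp add: sumset_def)

lemma sumset_Suc: "h \<ge> 1 \<Longrightarrow> sumset (Suc h) A = A + sumset h A"
  by (cases h) (simp_all add: sumset_def)

lemma basis_ord_eq_Least:
  assumes "additive_basis A"
  shows "basis_ord A = enat (LEAST h. h \<ge> 1 \<and> almost_eq (sumset h A) UNIV)"
proof -
  let ?P = "\<lambda>h. h \<ge> 1 \<and> almost_eq (sumset h A) UNIV"
  have "?P (LEAST h. ?P h)"
    using assms unfolding additive_basis_def by (metis (mono_tags, lifting) LeastI)
  then show ?thesis
    unfolding basis_ord_def
    by (intro antisym INF_lower INF_greatest) (auto intro: Least_le)
qed

lemma basis_ord_eq_infinity_iff: "basis_ord A = \<infinity> \<longleftrightarrow> \<not> additive_basis A"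
proof (cases "additive_basis A")
  case True
  then show ?thesis by (simp add: basis_ord_eq_Least)
next
  case False
  then have "{h. h \<ge> 1 \<and> almost_eq (sumset h A) UNIV} = {}" by (auto simp: additive_basis_def)
  with False show ?thesis unfolding basis_ord_def by (simp only: image_empty) (simp add: Inf_enat_def)
qed

end

theory Submission
  imports Defs Complex_Main
begin

text \<open>For \<open>a\<close> in \<open>A\<close>, put \<open>B = A - {a}\<close> and let \<open>X a\<close> be the set of elements missed by \<open>h B\<close>.
  For finite \<open>F\<close>, a point of \<open>h A\<close> outside the finite set \<open>h F\<close> has a representation
  using at most \<open>h - 1\<close> elements of \<open>F\<close>, hence lies in at most \<open>h - 1\<close> of the sets \<open>X a\<close>
  with \<open>a \<in> F\<close>. It remains to bound the density of \<open>X a\<close> from below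
  when \<open>2h B\<close> misses infinitely many \<open>x\<close>; densities are averages over finite families that are
  almost invariant under finitely many translations.

  In a group, \<open>x \<notin> 2h B\<close> means that \<open>z\<close> or \<open>x - z\<close> lies in \<open>X a\<close> for each \<open>z\<close>, so
  averaging over a family and its reflection gives density at least \<open>1/2\<close>.
  In general, almost every \<open>x - y\<close> is in \<open>j B + (h - j) a\<close> for some \<open>1 \<le> j \<le> h\<close>, and one \<open>j\<close>
  serves a proportion \<open>1/h\<close> of all \<open>y\<close>. Moving such a \<open>y\<close> by \<open>(h - j) a - (h - j) b\<close> with
  \<open>b \<in> B\<close> turns this into \<open>x \<in> j B + (h - j) b + y'\<close>, so \<open>y' \<notin> h B\<close>, and the density is at
  least \<open>1/h\<close>.\<close>

section \<open>Sumsets and representations\<close>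

lemma sumset_Suc_0 [simp]: "sumset (Suc 0) A = A"
  by (simp add: sumset_def)

lemma sumset_mono:
  assumes "A \<subseteq> B" "1 \<le> n"
  shows "sumset n A \<subseteq> sumset n B"
  using assms(2)
  by (induction n rule: nat_induct_at_least) (simp_all add: sumset_Suc assms(1) set_plus_mono2)

lemma finite_sumset:
  assumes "finite A" "1 \<le> n"
  shows "finite (sumset n A)"
  using assms(2)
  by (induction n rule: nat_induct_at_least) (simp_all add: sumset_Suc assms(1) finite_set_plus)

lemma add_mem_sumset:
  fixes A :: "'a::ab_semigroup_add set"
  assumes "1 \<le> m" "u \<in> sumset m A" "1 \<le> n" "v \<in> sumset n A"
  shows "u + v \<in> sumset (m + n) A"
  using assms(1,2)
proof (induction m arbitrary: u rule: nat_induct_at_least)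
  case base
  then show ?case using assms(3,4) by (simp add: sumset_Suc set_plus_intro)
next
  case (Suc m)
  then obtain a w where "a \<in> A" "w \<in> sumset m A" "u = a + w"
    by (auto simp: sumset_Suc elim: set_plus_elim)
  with Suc show ?case
    by (simp add: sumset_Suc set_plus_intro add.assoc)
qed

text \<open>Iterated translation by \<open>a\<close> encodes adding \<open>k\<close> copies of
  \<open>a\<close>. It makes sense for \<open>k = 0\<close> even if there is no neutral
  element.\<close>

lemma funpow_add_mem_sumset:
  fixes A :: "'a::ab_semigroup_add set"
  assumes "1 \<le> n" "v \<in> sumset n A" "a \<in> A"
  shows "((+) a ^^ k) v \<in> sumset (k + n) A"
  using assms by (induction k) (simp_all add: sumset_Suc set_plus_intro)

lemma funpow_add_commute:
  fixes a :: "'a::ab_semigroup_add"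
  shows "((+) a ^^ k) (x + y) = x + ((+) a ^^ k) y"
  by (induction k) (simp_all add: add.left_commute)

text \<open>Collect the copies of \<open>a\<close> in a representation of \<open>x\<close>. The sum
  of \<open>n\<close> copies of \<open>a\<close> is a separate case because \<open>sumset 0\<close>
  is a junk value.\<close>

lemma sumset_remove_cases:
  fixes A :: "'a::ab_semigroup_add set"
  assumes "1 \<le> n" "x \<in> sumset n A"
  shows "x = ((+) a ^^ (n - 1)) a \<or>
    (\<exists>j\<in>{1..n}. \<exists>u\<in>sumset j (A - {a}). x = ((+) a ^^ (n - j)) u)"
  using assms
proof (induction n arbitrary: x rule: nat_induct_at_least)
  case base
  then show ?case by auto
next
  case (Suc n)
  then obtain c y where c: "c \<in> A" and y: "y \<in> sumset n A" and x: "x = c + y"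
    by (auto simp: sumset_Suc elim: set_plus_elim)
  from Suc.IH[OF y] consider (pow) "y = ((+) a ^^ (n - 1)) a"
    | (split) j u where "j \<in> {1..n}" "u \<in> sumset j (A - {a})" "y = ((+) a ^^ (n - j)) u"
    by blast
  then show ?case
  proof cases
    case pow
    show ?thesis
    proof (cases "c = a")
      case True
      then have "x = ((+) a ^^ (Suc n - 1)) a"
        using x pow \<open>1 \<le> n\<close> by (cases n) simp_all
      then show ?thesis ..
    next
      case False
      have "x = ((+) a ^^ (n - 1)) (a + c)"
        using x pow by (metis add.commute funpow_add_commute)
      then have "x = ((+) a ^^ n) c"
        using \<open>1 \<le> n\<close> by (cases n) (simp_all add: funpow_swap1)
      with False c show ?thesis
        by (intro disjI2 bexI[of _ 1] bexI[of _ c]) simp_all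
    qed
  next
    case split
    show ?thesis
    proof (cases "c = a")
      case True
      with split x show ?thesis
        by (intro disjI2 bexI[of _ j] bexI[of _ u]) (simp_all add: Suc_diff_le)
    next
      case False
      with split c have "c + u \<in> sumset (Suc j) (A - {a})"
        by (simp add: sumset_Suc set_plus_intro)
      with split x show ?thesis
        by (intro disjI2 bexI[of _ "Suc j"] bexI[of _ "c + u"]) (simp_all add: funpow_add_commute)
    qed
  qed
qed

lemma sumset_finite_support:
  fixes A :: "'a::ab_semigroup_add set"
  assumes "1 \<le> n" "x \<in> sumset n A"
  obtains P where "P \<subseteq> A" "finite P" "card P \<le> n" "x \<in> sumset n P"
proof -
  have "\<exists>P\<subseteq>A. finite P \<and> card P \<le> n \<and> x \<in> sumset n P"
    using assms
  proof (induction n arbitrary: x rule: nat_induct_at_least)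
    case base
    then show ?case by (intro exI[of _ "{x}"]) simp
  next
    case (Suc n)
    then obtain c y where c: "c \<in> A" and y: "y \<in> sumset n A" and x: "x = c + y"
      by (auto simp: sumset_Suc elim: set_plus_elim)
    from Suc.IH[OF y] obtain P where P: "P \<subseteq> A" "finite P" "card P \<le> n" "y \<in> sumset n P"
      by blast
    have "y \<in> sumset n (insert c P)"
      using P(4) sumset_mono[OF subset_insertI \<open>1 \<le> n\<close>] by blast
    with P c x \<open>1 \<le> n\<close> show ?case
      by (intro exI[of _ "insert c P"]) (auto simp: sumset_Suc card_insert_if set_plus_intro)
  qed
  with that show ?thesis by blast
qed

section \<open>Cofinite sumsets and the order of a basis\<close>

lemma almost_eq_UNIV_iff: "almost_eq A UNIV \<longleftrightarrow> finite (- A)"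
  by (simp add: almost_eq_def Compl_eq_Diff_UNIV)

text \<open>Translating a cofinite set by a single \<open>a\<close> in \<open>A\<close> keeps it
  cofinite, by translatability.\<close>

lemma finite_Compl_sumset_mono:
  fixes A :: "'a::translatable_semigroup set"
  assumes "1 \<le> m" "m \<le> n" "finite (- sumset m A)"
  shows "finite (- sumset n A)"
  using assms(2,3)
proof (induction n rule: dec_induct)
  case base
  then show ?case .
next
  case (step n)
  have "A \<noteq> {}"
  proof
    assume "A = {}"
    with finite_sumset[of A m] assms infinite_carrier show False
      by (metis finite.emptyI finite_Un Compl_partition)
  qed
  then obtain a where "a \<in> A" by blast
  have "- sumset (Suc n) A \<subseteq> (UNIV - range ((+) a)) \<union> (+) a ` (- sumset n A)"
    using \<open>a \<in> A\<close> step.hyps assms(1) by (auto simp: sumset_Suc intro: set_plus_intro)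
  then show ?case
    using step finite_compl_translate finite_subset by (metis finite_UnI finite_imageI)
qed

lemma basis_finite_Compl_sumset:
  fixes A :: "'a::translatable_semigroup set"
  assumes "additive_basis A" "basis_ord A \<le> enat h"
  shows "finite (- sumset h A)"
proof -
  let ?P = "\<lambda>k. k \<ge> 1 \<and> almost_eq (sumset k A) UNIV"
  have "?P (LEAST k. ?P k)"
    using assms(1) unfolding additive_basis_def by (metis (mono_tags, lifting) LeastI)
  moreover have "(LEAST k. ?P k) \<le> h"
    using assms by (simp add: basis_ord_eq_Least)
  ultimately show ?thesis
    using finite_Compl_sumset_mono by (auto simp: almost_eq_UNIV_iff)
qed

lemma infinite_Compl_sumset_of_ord_gt:
  assumes "basis_ord A > enat n" "1 \<le> n"
  shows "infinite (- sumset n A)"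
proof
  assume "finite (- sumset n A)"
  then have "basis_ord A \<le> enat n"
    unfolding basis_ord_def using assms(2) by (intro INF_lower) (simp add: almost_eq_UNIV_iff)
  with assms(1) show False by simp
qed

lemma finite_add_vimage:
  fixes x :: "'a::cancel_semigroup_add"
  assumes "finite E"
  shows "finite {t. t + x \<in> E}"
proof -
  have "finite ((\<lambda>t. t + x) -` E)"
    using assms by (rule finite_vimageI) (simp add: inj_on_def)
  then show ?thesis by (simp add: vimage_def)
qed

lemma card_missed_less:
  fixes A :: "'a::ab_semigroup_add set"
  assumes "1 \<le> h" "z \<in> sumset h A" "finite F" "z \<notin> sumset h F"
  shows "card {a \<in> F. z \<notin> sumset h (A - {a})} \<le> h - 1"
proof -
  obtain P where P: "P \<subseteq> A" "finite P" "card P \<le> h" "z \<in> sumset h P"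
    using assms sumset_finite_support by blast
  \<comment> \<open>Some summand of \<open>z\<close> lies outside \<open>F\<close>; this lowers the
    bound from \<open>h\<close> to \<open>h - 1\<close>.\<close>
  have "\<not> P \<subseteq> F"
    using sumset_mono[of P F h] assms P(4) by auto
  then have "card (F \<inter> P) < card P"
    using P(2) by (intro psubset_card_mono) auto
  \<comment> \<open>Deleting an element outside \<open>P\<close> leaves the representation of
    \<open>z\<close> intact.\<close>
  moreover have "{a \<in> F. z \<notin> sumset h (A - {a})} \<subseteq> F \<inter> P"
  proof safe
    fix a assume "z \<notin> sumset h (A - {a})"
    then have "\<not> P \<subseteq> A - {a}"
      using sumset_mono[of P "A - {a}" h] assms(1) P(4) by auto
    then show "a \<in> P" using P(1) by blast
  qed
  moreover from this have "card {a \<in> F. z \<notin> sumset h (A - {a})} \<le> card (F \<inter> P)"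
    using P(2) by (intro card_mono) auto
  ultimately show ?thesis using P(3) by linarith
qed

section \<open>Means over finite families and almost invariance\<close>

definition mean :: "'a list \<Rightarrow> ('a \<Rightarrow> real) \<Rightarrow> real" where
  "mean ws f = (\<Sum>w\<leftarrow>ws. f w) / real (length ws)"

lemma mean_mono: "(\<And>w. w \<in> set ws \<Longrightarrow> f w \<le> g w) \<Longrightarrow> mean ws f \<le> mean ws g"
  unfolding mean_def by (intro divide_right_mono sum_list_mono) auto

lemma mean_const: "ws \<noteq> [] \<Longrightarrow> mean ws (\<lambda>_. c) = c"
  by (simp add: mean_def sum_list_triv)

lemma mean_add: "mean ws (\<lambda>w. f w + g w) = mean ws f + mean ws g"
  by (simp add: mean_def sum_list_addf add_divide_distrib)

lemma mean_sum: "mean ws (\<lambda>w. \<Sum>i\<in>I. f i w) = (\<Sum>i\<in>I. mean ws (f i))"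
proof (induction I rule: infinite_finite_induct)
  case (insert i I)
  then show ?case by (simp add: mean_add)
qed (simp_all add: mean_def)

lemma mean_map: "mean (map g ws) f = mean ws (\<lambda>x. f (g x))"
  by (simp add: mean_def o_def)

lemma mean_concat_map:
  assumes "\<And>k. length (g k) = L"
  shows "mean (concat (map g [0..<n])) f = (\<Sum>k<n. mean (g k) f) / real n"
proof -
  have "length (concat (map g [0..<n])) = n * L"
    using assms by (induction n) simp_all
  moreover have "(\<Sum>w\<leftarrow>concat (map g [0..<n]). f w) = (\<Sum>k<n. \<Sum>w\<leftarrow>g k. f w)"
    by (induction n) simp_all
  ultimately show ?thesis
    by (simp add: mean_def assms sum_divide_distrib mult.commute)
qed

text \<open>A Folner condition: for nonempty \<open>ws\<close>, the uniform distribution on its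
  entries, with multiplicity, and its translate by \<open>d\<close> have total variation distance at
  most \<epsilon>.\<close>

definition almost_invariant :: "'a::plus list \<Rightarrow> real \<Rightarrow> 'a \<Rightarrow> bool" where
  "almost_invariant ws \<epsilon> d \<longleftrightarrow>
    (\<forall>f. (\<forall>x. f x \<in> {0..1}) \<longrightarrow> \<bar>mean ws (\<lambda>x. f (d + x)) - mean ws f\<bar> \<le> \<epsilon>)"

lemma almost_invariantD:
  "almost_invariant ws \<epsilon> d \<Longrightarrow> (\<And>x. f x \<in> {0..1}) \<Longrightarrow>
    \<bar>mean ws (\<lambda>x. f (d + x)) - mean ws f\<bar> \<le> \<epsilon>"
  unfolding almost_invariant_def by blast

lemma almost_invariant_funpow:
  assumes "almost_invariant ws \<epsilon> d" "\<And>x. f x \<in> {0..1}"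
  shows "\<bar>mean ws (\<lambda>x. f (((+) d ^^ k) x)) - mean ws f\<bar> \<le> real k * \<epsilon>"
proof (induction k)
  case 0
  then show ?case by simp
next
  case (Suc k)
  have "\<bar>mean ws (\<lambda>x. f (((+) d ^^ k) (d + x))) - mean ws (\<lambda>x. f (((+) d ^^ k) x))\<bar> \<le> \<epsilon>"
    using almost_invariantD[OF assms(1), of "\<lambda>x. f (((+) d ^^ k) x)"] assms(2) by blast
  with Suc show ?case
    by (simp add: funpow_swap1 algebra_simps)
qed

text \<open>Amenability of abelian semigroups, by adding one direction at a time. Averaging over
  successive translates by a new \<open>d\<close> creates invariance under \<open>d\<close>, and
  commutativity preserves the invariance already obtained.\<close>

lemma almost_invariant_exists:
  fixes D :: "'a::ab_semigroup_add set"
  assumes "finite D" "0 < \<epsilon>"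
  shows "\<exists>ws. ws \<noteq> [] \<and> (\<forall>d\<in>D. almost_invariant ws \<epsilon> d)"
  using assms(1)
proof induction
  case empty
  show ?case by (intro exI[of _ "[undefined]"]) simp
next
  case (insert d D)
  then obtain ws where ws: "ws \<noteq> []" "\<And>c. c \<in> D \<Longrightarrow> almost_invariant ws \<epsilon> c"
    by blast
  obtain n where n: "inverse (real (Suc n)) < \<epsilon>"
    using reals_Archimedean[OF assms(2)] by blast
  \<comment> \<open>Overlapping translates must count with multiplicity, hence a list and not a
    set.\<close>
  define us where "us = concat (map (\<lambda>k. map ((+) d ^^ k) ws) [0..<Suc n])"
  have mean_us: "mean us f = (\<Sum>k<Suc n. mean ws (\<lambda>x. f (((+) d ^^ k) x))) / real (Suc n)" for f
    unfolding us_def by (subst mean_concat_map[where L = "length ws"]) (simp_all add: mean_map)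
  have "us \<noteq> []"
    using ws(1) by (simp add: us_def upt_conv_Cons del: upt_Suc)
  moreover have "almost_invariant us \<epsilon> d"
    unfolding almost_invariant_def
  proof (intro allI impI)
    fix f :: "'a \<Rightarrow> real" assume f: "\<forall>x. f x \<in> {0..1}"
    define s where "s k = mean ws (\<lambda>x. f (((+) d ^^ k) x))" for k
    have s: "0 \<le> s k \<and> s k \<le> 1" for k
    proof -
      have "mean ws (\<lambda>_. 0) \<le> s k" "s k \<le> mean ws (\<lambda>_. 1)"
        unfolding s_def by (intro mean_mono; use f in simp)+
      then show ?thesis by (simp add: mean_const ws(1))
    qed
    \<comment> \<open>Translation by \<open>d\<close> turns block \<open>k\<close> into block
      \<open>Suc k\<close>, so only the two end terms survive.\<close>
    have "mean us (\<lambda>x. f (d + x)) - mean us f = (\<Sum>k<Suc n. s (Suc k) - s k) / real (Suc n)"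
      unfolding mean_us s_def by (simp only: sum_subtractf diff_divide_distrib funpow.simps o_apply)
    also have "\<dots> = (s (Suc n) - s 0) / real (Suc n)"
      by (simp only: sum_lessThan_telescope)
    finally have "\<bar>mean us (\<lambda>x. f (d + x)) - mean us f\<bar> \<le> 1 / real (Suc n)"
      using s[of 0] s[of "Suc n"] by (simp add: divide_right_mono abs_le_iff)
    with n show "\<bar>mean us (\<lambda>x. f (d + x)) - mean us f\<bar> \<le> \<epsilon>"
      by (simp add: inverse_eq_divide)
  qed
  moreover have "almost_invariant us \<epsilon> c" if "c \<in> D" for c
    unfolding almost_invariant_def
  proof (intro allI impI)
    fix f :: "'a \<Rightarrow> real" assume f: "\<forall>x. f x \<in> {0..1}"
    \<comment> \<open>Since \<open>c\<close> commutes with the translations by \<open>d\<close>,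
      each block inherits the error \<epsilon> from \<open>ws\<close>, and so does their
      average.\<close>
    define g where "g k x = f (((+) d ^^ k) x)" for k x
    have "\<bar>mean ws (\<lambda>x. g k (c + x)) - mean ws (g k)\<bar> \<le> \<epsilon>" for k
    proof (rule almost_invariantD[OF ws(2)[OF that]])
      show "g k x \<in> {0..1}" for x using f unfolding g_def by blast
    qed
    then have "(\<Sum>k<Suc n. \<bar>mean ws (\<lambda>x. g k (c + x)) - mean ws (g k)\<bar>) \<le> (\<Sum>k<Suc n. \<epsilon>)"
      by (intro sum_mono)
    also have "\<dots> = real (Suc n) * \<epsilon>" by (simp only: sum_constant card_lessThan)
    finally have "(\<Sum>k<Suc n. \<bar>mean ws (\<lambda>x. g k (c + x)) - mean ws (g k)\<bar>) \<le> real (Suc n) * \<epsilon>" .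
    then have "\<bar>\<Sum>k<Suc n. mean ws (\<lambda>x. g k (c + x)) - mean ws (g k)\<bar> \<le> real (Suc n) * \<epsilon>"
      by (rule order_trans[OF sum_abs])
    moreover have "mean us (\<lambda>x. f (c + x)) - mean us f =
        (\<Sum>k<Suc n. mean ws (\<lambda>x. g k (c + x)) - mean ws (g k)) / real (Suc n)"
      unfolding mean_us g_def by (simp only: sum_subtractf diff_divide_distrib funpow_add_commute[of _ d c])
    ultimately show "\<bar>mean us (\<lambda>x. f (c + x)) - mean us f\<bar> \<le> \<epsilon>"
      by (simp add: divide_le_eq mult.commute del: sum.lessThan_Suc of_nat_Suc)
  qed
  ultimately show ?case by blast
qed

text \<open>A common shift by \<open>t\<close> preserves almost invariance, as
  \<open>f (t + x)\<close> is again a test function of \<open>x\<close>. By cancellation only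
  finitely many \<open>t\<close> send an entry into \<open>E\<close>.\<close>

lemma almost_invariant_avoiding:
  fixes D E :: "'a::translatable_semigroup set"
  assumes "finite D" "finite E" "0 < \<epsilon>"
  obtains ws where "ws \<noteq> []" "set ws \<inter> E = {}" "\<And>d. d \<in> D \<Longrightarrow> almost_invariant ws \<epsilon> d"
proof -
  obtain ws where ws: "ws \<noteq> []" "\<And>d. d \<in> D \<Longrightarrow> almost_invariant ws \<epsilon> d"
    using almost_invariant_exists[OF assms(1,3)] by blast
  have "finite (\<Union>w\<in>set ws. {t. t + w \<in> E})"
    using assms(2) by (simp add: finite_add_vimage)
  then obtain t where t: "t \<notin> (\<Union>w\<in>set ws. {t. t + w \<in> E})"
    using ex_new_if_finite[OF infinite_carrier] by blast
  show ?thesis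
  proof
    show "map ((+) t) ws \<noteq> []" using ws(1) by simp
    show "set (map ((+) t) ws) \<inter> E = {}" using t by auto
    fix d assume "d \<in> D"
    show "almost_invariant (map ((+) t) ws) \<epsilon> d"
      unfolding almost_invariant_def mean_map
      using almost_invariantD[OF ws(2)[OF \<open>d \<in> D\<close>], of "\<lambda>x. f (t + x)" for f]
      by (simp add: add.left_commute)
  qed
qed

section \<open>Densities of the sets of missed points\<close>

lemma sum_mean_missed_le:
  fixes A :: "'a::ab_semigroup_add set"
  assumes "1 \<le> h" "finite F" "ws \<noteq> []" "set ws \<subseteq> sumset h A - sumset h F"
  shows "(\<Sum>a\<in>F. mean ws (\<lambda>z. of_bool (z \<notin> sumset h (A - {a})))) \<le> real (h - 1)"
proof -
  have "(\<Sum>a\<in>F. mean ws (\<lambda>z. of_bool (z \<notin> sumset h (A - {a})))) =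
      mean ws (\<lambda>z. \<Sum>a\<in>F. of_bool (z \<notin> sumset h (A - {a})))"
    by (rule mean_sum[symmetric])
  also have "\<dots> \<le> mean ws (\<lambda>_. real (h - 1))"
  proof (rule mean_mono)
    fix z assume "z \<in> set ws"
    moreover from this have "card {a \<in> F. z \<notin> sumset h (A - {a})} \<le> h - 1"
      using assms by (intro card_missed_less) auto
    then show "(\<Sum>a\<in>F. of_bool (z \<notin> sumset h (A - {a}))) \<le> real (h - 1)"
      using assms(2) by (simp add: of_bool_def sum.If_cases Int_def flip: sum.inter_filter)
  qed
  finally show ?thesis using assms(3) by (simp add: mean_const)
qed

lemma one_le_mean_missed:
  fixes A :: "'a::translatable_semigroup set"
  assumes h: "1 \<le> h" "finite (- sumset h A)"
    and b: "b \<in> A" "b \<noteq> a"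
    and bad: "infinite (- sumset (2 * h) (A - {a}))"
    and ws: "ws \<noteq> []" "almost_invariant ws \<epsilon> a" "almost_invariant ws \<epsilon> b"
    and eps: "0 < \<epsilon>"
  shows "1 \<le> real h * (mean ws (\<lambda>z. of_bool (z \<notin> sumset h (A - {a}))) + 2 * real h * \<epsilon>)"
proof -
  define B where "B = A - {a}"
  define q where "q = ((+) a ^^ (h - 1)) a"
  \<comment> \<open>The finitely many \<open>x\<close> for which some difference x - w, with
    \<open>w\<close> in \<open>ws\<close>, does not exist, equals \<open>q\<close> (that is,
    \<open>h\<close> copies of \<open>a\<close>), or is missed by \<open>sumset h A\<close>.\<close>
  define K where "K = (\<Union>w\<in>set ws. (UNIV - range ((+) w)) \<union> (+) w ` (insert q (- sumset h A)))"
  have "finite K"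
    unfolding K_def using h(2) by (auto simp: finite_compl_translate)
  then have "infinite (- sumset (2 * h) B - K)"
    using bad by (simp add: B_def Diff_infinite_finite)
  then obtain x where "x \<in> - sumset (2 * h) B - K"
    by (metis ex_in_conv infinite_imp_nonempty)
  then have x: "x \<notin> sumset (2 * h) B"
    and x': "\<And>w. w \<in> set ws \<Longrightarrow> x \<in> range ((+) w)"
    "\<And>w. w \<in> set ws \<Longrightarrow> x \<notin> (+) w ` insert q (- sumset h A)"
    by (auto simp: K_def)
  define g :: "nat \<Rightarrow> 'a \<Rightarrow> real"
    where "g j y = of_bool (\<exists>u\<in>sumset j B. x = y + ((+) a ^^ (h - j)) u)" for j y
  define f :: "'a \<Rightarrow> real" where "f z = of_bool (z \<notin> sumset h B)" for z
  have cover: "1 \<le> (\<Sum>j\<in>{1..h}. g j w)" if w: "w \<in> set ws" for w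
  proof -
    obtain c where c: "x = w + c" using x'(1)[OF w] by blast
    with x'(2)[OF w] have "c \<noteq> q" "c \<in> sumset h A" by blast+
    then obtain j u where j: "j \<in> {1..h}" "u \<in> sumset j B" "c = ((+) a ^^ (h - j)) u"
      using sumset_remove_cases[OF h(1), of c A a] unfolding B_def q_def by blast
    then have "g j w = 1" using c by (auto simp: g_def)
    then show ?thesis
      using member_le_sum[of j "{1..h}" "\<lambda>j. g j w"] j(1) by (simp add: g_def)
  qed
  have mean_g: "mean ws (g j) \<le> mean ws f + 2 * real h * \<epsilon>" if j: "j \<in> {1..h}" for j
  proof -
    define k where "k = h - j"
    \<comment> \<open>To avoid subtraction, the point y and its shift y' are written as k b + v and
      k a + v. If x = y + k a + u, then x = (k b + u) + y', where k b + u is a sum of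
      \<open>h\<close> elements of \<open>B\<close>.\<close>
    have "g j (((+) b ^^ k) v) \<le> f (((+) a ^^ k) v)" for v
    proof -
      have False if u: "u \<in> sumset j B" "x = ((+) b ^^ k) v + ((+) a ^^ k) u"
        and v: "((+) a ^^ k) v \<in> sumset h B" for u
      proof -
        have "x = ((+) b ^^ k) u + ((+) a ^^ k) v"
          using u(2) by (metis add.commute funpow_add_commute)
        moreover have "((+) b ^^ k) u \<in> sumset (k + j) B"
          using j u(1) b by (intro funpow_add_mem_sumset) (auto simp: B_def)
        ultimately have "x \<in> sumset ((k + j) + h) B"
          using v h(1) j add_mem_sumset[of "k + j" _ B h] by auto
        with x j show False by (simp add: k_def mult_2)
      qed
      then show ?thesis by (auto simp: g_def f_def k_def)
    qed
    then have "mean ws (\<lambda>v. g j (((+) b ^^ k) v)) \<le> mean ws (\<lambda>v. f (((+) a ^^ k) v))"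
      by (intro mean_mono)
    \<comment> \<open>Removing the shifts by k b and by k a costs k \<epsilon> each, whence the
      error 2 h \<epsilon>.\<close>
    moreover have "\<bar>mean ws (\<lambda>v. g j (((+) b ^^ k) v)) - mean ws (g j)\<bar> \<le> real k * \<epsilon>"
      by (rule almost_invariant_funpow[OF ws(3)]) (simp add: g_def)
    moreover have "\<bar>mean ws (\<lambda>v. f (((+) a ^^ k) v)) - mean ws f\<bar> \<le> real k * \<epsilon>"
      by (rule almost_invariant_funpow[OF ws(2)]) (simp add: f_def)
    moreover have "real k * \<epsilon> \<le> real h * \<epsilon>"
      using eps by (simp add: k_def)
    ultimately show ?thesis by linarith
  qed
  have "1 = mean ws (\<lambda>_. 1)" using ws(1) by (simp add: mean_const)
  also have "\<dots> \<le> mean ws (\<lambda>w. \<Sum>j\<in>{1..h}. g j w)" by (intro mean_mono cover)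
  also have "\<dots> = (\<Sum>j\<in>{1..h}. mean ws (g j))" by (rule mean_sum)
  also have "\<dots> \<le> real h * (mean ws f + 2 * real h * \<epsilon>)"
    using sum_bounded_above[of "{1..h}" "\<lambda>j. mean ws (g j)"] mean_g by simp
  finally show ?thesis unfolding f_def B_def .
qed

lemma card_bad_le:
  fixes A :: "'a::translatable_semigroup set"
  assumes h: "1 \<le> h" "finite (- sumset h A)"
    and F: "finite F" "F \<subseteq> A" "\<And>a. a \<in> F \<Longrightarrow> infinite (- sumset (2 * h) (A - {a}))"
  shows "card F \<le> h * (h - 1)"
proof -
  have "infinite A"
    using finite_sumset[of A h] h infinite_carrier by (metis finite_Un Compl_partition)
  then have "\<not> A \<subseteq> F"
    using finite_subset[OF _ F(1)] by blast
  \<comment> \<open>One \<open>b\<close> outside \<open>F\<close> serves all \<open>a\<close> in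
    \<open>F\<close> at once, so one list \<open>ws\<close> can be almost invariant for every
    direction in use.\<close>
  then obtain b where b: "b \<in> A" "b \<notin> F" by blast
  define n where "n = real (card F)"
  \<comment> \<open>Chosen so that the errors summed over \<open>F\<close> come to n / (n + 1) < 1,
    which integrality absorbs at the end.\<close>
  define \<epsilon> where "\<epsilon> = 1 / (2 * real h ^ 2 * (n + 1))"
  have eps: "0 < \<epsilon>" using h(1) by (simp add: \<epsilon>_def n_def)
  have "finite (insert b F)" "finite (- sumset h A \<union> sumset h F)"
    using F(1) h finite_sumset[of F h] by simp_all
  from almost_invariant_avoiding[OF this eps]
  obtain ws where ws: "ws \<noteq> []" "set ws \<inter> (- sumset h A \<union> sumset h F) = {}"
    "\<And>d. d \<in> insert b F \<Longrightarrow> almost_invariant ws \<epsilon> d"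
    by metis
  define m where "m a = mean ws (\<lambda>z. of_bool (z \<notin> sumset h (A - {a})))" for a
  have "1 \<le> real h * (m a + 2 * real h * \<epsilon>)" if "a \<in> F" for a
    unfolding m_def using that b ws F(3) eps by (intro one_le_mean_missed h) auto
  then have "(\<Sum>a\<in>F. 1) \<le> (\<Sum>a\<in>F. real h * (m a + 2 * real h * \<epsilon>))"
    by (intro sum_mono)
  also have "\<dots> = real h * (\<Sum>a\<in>F. m a) + n * (2 * real h ^ 2 * \<epsilon>)"
    by (simp add: sum.distrib sum_distrib_left algebra_simps power2_eq_square n_def)
  also have "2 * real h ^ 2 * \<epsilon> = 1 / (n + 1)"
    using h(1) by (simp add: \<epsilon>_def)
  also have "(\<Sum>a\<in>F. m a) \<le> real (h - 1)"
    unfolding m_def using ws F(1) h(1) by (intro sum_mean_missed_le) auto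
  finally have "n \<le> real h * real (h - 1) + n * (1 / (n + 1))"
    by (simp add: n_def mult_left_mono)
  moreover have "n * (1 / (n + 1)) < 1" by (simp add: n_def)
  ultimately have "n < real h * real (h - 1) + 1" by linarith
  then have "real (card F) < real (h * (h - 1) + 1)"
    by (simp add: n_def)
  then show ?thesis by linarith
qed

lemma card_bad_le_group:
  fixes A :: "'a::translatable_semigroup set"
  assumes h: "1 \<le> h" "finite (- sumset h A)"
    and F: "finite F" "\<And>a. a \<in> F \<Longrightarrow> infinite (- sumset (2 * h) (A - {a}))"
    and G: "is_group TYPE('a)"
  shows "card F \<le> 2 * (h - 1)"
proof -
  obtain e :: 'a and neg where "group (+) e neg"
    using G unfolding is_group_def by blast
  then interpret group "(+)" e neg .
  have "\<forall>a\<in>F. \<exists>x. x \<notin> sumset (2 * h) (A - {a})"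
    using F(2) by (metis Compl_iff finite.emptyI subsetI subset_empty)
  then obtain x where x: "\<And>a. a \<in> F \<Longrightarrow> x a \<notin> sumset (2 * h) (A - {a})"
    by metis
  define n where "n = real (card F)"
  define \<epsilon> where "\<epsilon> = 1 / (n + 1)"
  have eps: "0 < \<epsilon>" by (simp add: \<epsilon>_def n_def)
  \<comment> \<open>The list avoids \<open>E\<close> and its negatives, so that the reflected list
    also stays in \<open>sumset h A\<close> and off \<open>sumset h F\<close>.\<close>
  define E where "E = - sumset h A \<union> sumset h F"
  have "finite ((\<lambda>a. neg (x a)) ` F)" "finite (E \<union> neg ` E)"
    unfolding E_def using h F(1) finite_sumset[of F h] by simp_all
  from almost_invariant_avoiding[OF this eps]
  obtain ws where ws: "ws \<noteq> []" "set ws \<inter> (E \<union> neg ` E) = {}"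
    "\<And>a. a \<in> F \<Longrightarrow> almost_invariant ws \<epsilon> (neg (x a))"
    by (metis imageI)
  define f :: "'a \<Rightarrow> 'a \<Rightarrow> real" where "f a z = of_bool (z \<notin> sumset h (A - {a}))" for a z
  have neg_ws: "set (map neg ws) \<inter> E = {}"
  proof -
    have "w \<in> neg ` E" if "neg w \<in> E" for w
      using that by (metis image_eqI inverse_inverse)
    with ws(2) show ?thesis by auto
  qed
  have "1 \<le> mean ws (f a) + mean (map neg ws) (f a) + \<epsilon>" if a: "a \<in> F" for a
  proof -
    \<comment> \<open>The second argument is x - z, written as the negative of a translate of z:
      almost invariance then removes the translation and leaves the mean over the reflected
      list.\<close>
    have "1 \<le> f a z + f a (neg (neg (x a) + z))" for z
    proof -
      have "z + neg (neg (x a) + z) = x a"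
        by (metis add.commute add.assoc inverse_inverse left_inverse right_inverse left_neutral right_neutral)
      then have "z \<notin> sumset h (A - {a}) \<or> neg (neg (x a) + z) \<notin> sumset h (A - {a})"
        using x[OF a] add_mem_sumset[of h z "A - {a}" h] h(1) by (metis mult_2)
      then show ?thesis by (auto simp: f_def)
    qed
    then have "mean ws (\<lambda>_. 1) \<le> mean ws (\<lambda>z. f a z + f a (neg (neg (x a) + z)))"
      by (intro mean_mono)
    moreover have "\<bar>mean ws (\<lambda>z. f a (neg (neg (x a) + z))) - mean ws (\<lambda>z. f a (neg z))\<bar> \<le> \<epsilon>"
      by (rule almost_invariantD[OF ws(3)[OF a]]) (simp add: f_def)
    ultimately show ?thesis
      using ws(1) by (simp add: mean_add mean_map mean_const)
  qed
  then have "(\<Sum>a\<in>F. 1) \<le> (\<Sum>a\<in>F. mean ws (f a) + mean (map neg ws) (f a) + \<epsilon>)"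
    by (intro sum_mono)
  also have "\<dots> = (\<Sum>a\<in>F. mean ws (f a)) + (\<Sum>a\<in>F. mean (map neg ws) (f a)) + n * \<epsilon>"
    by (simp add: sum.distrib n_def)
  also have "(\<Sum>a\<in>F. mean ws (f a)) \<le> real (h - 1)"
    unfolding f_def using ws F(1) h(1) by (intro sum_mean_missed_le) (auto simp: E_def)
  also have "(\<Sum>a\<in>F. mean (map neg ws) (f a)) \<le> real (h - 1)"
    unfolding f_def using ws(1) neg_ws F(1) h(1) by (intro sum_mean_missed_le) (auto simp: E_def)
  finally have "n \<le> 2 * real (h - 1) + n * \<epsilon>"
    by (simp add: n_def)
  moreover have "n * \<epsilon> < 1" by (simp add: n_def \<epsilon>_def)
  ultimately have "real (card F) < real (2 * (h - 1) + 1)"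
    by (simp add: n_def)
  then show ?thesis by linarith
qed

theorem theorem9:
  fixes h :: nat
  assumes "h \<ge> 2"
  shows "S_fun TYPE('a::translatable_semigroup) h \<le> enat (2 * h) \<and>
    (\<forall>A :: 'a set. additive_basis A \<and> basis_ord A \<le> enat h \<longrightarrow>
      finite {a \<in> A. basis_ord (A - {a}) > enat (2 * h)} \<and>
      card {a \<in> A. basis_ord (A - {a}) > enat (2 * h)} \<le> h * (h - 1)) \<and>
    (is_group TYPE('a) \<longrightarrow>
      (\<forall>A :: 'a set. additive_basis A \<and> basis_ord A \<le> enat h \<longrightarrow>
        finite {a \<in> A. basis_ord (A - {a}) > enat (2 * h)} \<and>
        card {a \<in> A. basis_ord (A - {a}) > enat (2 * h)} \<le> 2 * (h - 1)))"
proof -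
  have h: "1 \<le> h" "1 \<le> 2 * h" using assms by simp_all
  have basis: "finite (- sumset h A)" if "additive_basis A \<and> basis_ord A \<le> enat h" for A :: "'a set"
    using that basis_finite_Compl_sumset by blast
  have bad: "infinite (- sumset (2 * h) (A - {a}))"
    if "G \<subseteq> {a \<in> A. basis_ord (A - {a}) > enat (2 * h)}" "a \<in> G" for A G :: "'a set" and a
    using that infinite_Compl_sumset_of_ord_gt[OF _ h(2)] by blast
  have semigroup_case: "finite {a \<in> A. basis_ord (A - {a}) > enat (2 * h)} \<and>
      card {a \<in> A. basis_ord (A - {a}) > enat (2 * h)} \<le> h * (h - 1)"
    if "additive_basis A \<and> basis_ord A \<le> enat h" for A :: "'a set"
  \<comment> \<open>A uniform bound on the finite subsets gives both finiteness and the cardinality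
    bound.\<close>
  proof (rule finite_if_finite_subsets_card_bdd)
    fix G assume G: "G \<subseteq> {a \<in> A. basis_ord (A - {a}) > enat (2 * h)}" "finite G"
    then have "G \<subseteq> A" by blast
    with card_bad_le[OF h(1) basis[OF that] G(2) _ bad[OF G(1)]]
    show "card G \<le> h * (h - 1)" by simp
  qed
  have group_case: "finite {a \<in> A. basis_ord (A - {a}) > enat (2 * h)} \<and>
      card {a \<in> A. basis_ord (A - {a}) > enat (2 * h)} \<le> 2 * (h - 1)"
    if "is_group TYPE('a)" "additive_basis A \<and> basis_ord A \<le> enat h" for A :: "'a set"
  proof (rule finite_if_finite_subsets_card_bdd)
    fix G assume G: "G \<subseteq> {a \<in> A. basis_ord (A - {a}) > enat (2 * h)}" "finite G"
    show "card G \<le> 2 * (h - 1)"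
      using card_bad_le_group[OF h(1) basis[OF that(2)] G(2) bad[OF G(1)] that(1)] by simp
  qed
  have "S_fun TYPE('a) h \<le> enat (2 * h)"
    unfolding S_fun_def using semigroup_case by (intro INF_lower) simp
  with semigroup_case group_case show ?thesis by blast
qed

end
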